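(* Let $t_1,t_2\in T$ be finite trees and let $\Xi$ be an equation system. If the unification algorithm produces an equation system $\Xi'$, i.e. $\mathit{unify}_\Xi(t_1,t_2)=\Xi'$ (no failure), then: 1. there is a substitution $\sigma:\mathbb{V}\to T^\infty$ such that $\llbracket\Xi'\rrbracket_{image}=\sigma\circ\llbracket\Xi\rrbracket_{image}$; 2. $t_1\llbracket\Xi'\rrbracket_{image}=t_2\llbracket\Xi'\rrbracket_{image}$.
   Context: **Trees.** $\mathbb{V}$ (variables) and $\mathbb{C}$ (constructors) are countably infinite sets, with an arity function $\mathbb{C}\to\mathbb{N}$ (arity $0$ allowed); $f^n$ denotes a constructor $f$ of arity $n$. The set $T$ of finite trees is the least fixed point, and the set $T^\infty$ of possibly infinite trees the greatest fixed point, of the grammar $t::=x\mid f^n(t_1,\dots,t_n)$ with $x\in\mathbb{V}$; thus $T\subseteq T^\infty$. A head tree is a tree $f^n(x_1,\dots,x_n)$ with all $x_i\in\mathbb{V}$; $T^H$ is the set of head trees. **Substitutions.** A substitution is a map $\sigma:\mathbb{V}\to T^\infty$; $t\sigma$ denotes the result of replacing (corecursively) each variable $x$ of $t\in T^\infty$ by $\sigma(x)$, and $(\sigma\circ\tau)(x)=(\tau(x))\sigma$. **Equation systems.** An equation is written $[X\equiv y,\,t]$, where $X$ is a non-empty set of variables, $y\in X$ is the representing variable, and $t$ is either a head tree or $\bot$ (missing). An equation system $\Xi$ is a finite set of equations with pairwise disjoint left-hand sides $X$. $dom(\Xi)$ is the union of its left-hand sides. $\Xi,(X\equiv x,t)$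 denotes the system obtained by removing from $\Xi$ all equations whose left-hand side intersects $X$ and then adding $[X\equiv x,t]$. **Image.** $image_\Xi:\mathbb{V}\to T^\infty$ is defined coinductively: $image_\Xi(x)=x$ if $x\notin dom(\Xi)$; $image_\Xi(x)=y$ if $[X\equiv y,\bot]\in\Xi$ and $x\in X$; $image_\Xi(x)=f^n(image_\Xi(x_1),\dots,image_\Xi(x_n))$ if $[X\equiv y,f^n(x_1,\dots,x_n)]\in\Xi$ and $x\in X$. $\llbracket\Xi\rrbracket_{image}$ denotes $image_\Xi$ viewed as a substitution. **Operations.** - $\mathit{find}_\Xi(x)=(x,\bot)$ if $x\notin dom(\Xi)$; $\mathit{find}_\Xi(x)=(x',t)$ if $[X\equiv x',t]\in\Xi$ and $x\in X$. - $bind_\Xi(x,t)=\Xi,(\{x\}\equiv x,t)$ if $x\notin dom(\Xi)$; $bind_\Xi(x,t)=\Xi,(X\equiv x',t)$ if $[X\equiv x',t']\in\Xi$ and $x\in X$ (here $t\in T^H$). - $union_\Xi(x,y)$ returns an equation system together with either $\bot$ or a pair of head trees: (i) $union_\Xi(x,x)=\Xi,\bot$; (ii) if $x\ne y$ and $x,y\notin dom(\Xi)$: $[\Xi,(\{x,y\}\equiv x,\bot)],\bot$; (iii) if $[X\equiv x',t]\in\Xi$, $x\in X$, $y\notin dom(\Xi)$: $[\Xi,(X\cup\{y\}\equiv x',t)],\bot$; (iv) if $x\notin dom(\Xi)$ and $y\in dom(\Xi)$: $union_\Xi(y,x)$; (v) if $x,y$ belong to the left-hand side of the same equation: $\Xi,\bot$;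 (vi) if $[X\equiv x',t_1],[Y\equiv y',t_2]\in\Xi$ are distinct equations, $x\in X$, $y\in Y$: if $t_1,t_2$ are both head trees, the result is $[\Xi,(X\cup Y\equiv x',t_1)],(t_1,t_2)$; otherwise it is $[\Xi,(X\cup Y\equiv x',t)],\bot$, where $t$ is the one of $t_1,t_2$ that is a head tree if there is one, and $t=\bot$ otherwise. **Unification algorithm.** $\mathit{unify}_\Xi(t,s)$, for $t,s\in T$, returns an equation system or $\bot$ (failure), according to the following rules; failure of any recursive call makes the whole computation fail. - For variables $x,y$: if $union_\Xi(x,y)=\Xi',\bot$, the result is $\Xi'$; if $union_\Xi(x,y)=\Xi',(t_1,t_2)$, the result is $\mathit{unify}_{\Xi'}(t_1,t_2)$. - For a variable $x$ and a non-variable tree $t=f^n(t_1,\dots,t_n)$: if $\mathit{find}_\Xi(x)=(x',t')$ with $t'\neq\bot$, the result is $\mathit{unify}_\Xi(t',t)$. If $\mathit{find}_\Xi(x)=(x',\bot)$, choose fresh distinct variables $y_1,\dots,y_n$ (distinct from all variables occurring in the original inputs, including the original equation system, in the current $\Xi$, and from all variables generated so far), set $\Xi_0=bind_\Xi(x',f^n(y_1,\dots,y_n))$ and $\Xi_i=\mathit{unify}_{\Xi_{i-1}}(y_i,t_i)$ for $i=1,\dots,n$; the result is $\Xi_n$. - For a non-variable tree $t$ and a variable $x$: $\mathit{unify}_\Xi(t,x)$ is computed by the preceding rules as $\mathit{unify}_\Xi(x,t)$. - $\mathit{unify}_{\Xi_0}(f^n(t_1,\dots,t_n),f^n(t'_1,\dots,t'_n))=\Xi_n$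 where $\Xi_i=\mathit{unify}_{\Xi_{i-1}}(t_i,t'_i)$ for $i=1,\dots,n$. - $\mathit{unify}_\Xi(f^n(\dots),g^m(\dots))=\bot$ if $f^n\neq g^m$. *)

theory Defs
  imports "HOL-Library.Countable" "HOL-Library.Infinite_Typeclass"
begin

section \<open>Trees\<close>

text \<open>The codatatype contains raw trees that need not respect the arities. The sets \<open>T\<close> and
  \<open>T\<^sup>\<infinity>\<close> are the least and the greatest fixed point of the grammar, relative to an arity
  function \<open>ar\<close>.\<close>

codatatype (tree_vars: 'v, tree_cons: 'c) tree =
  Var 'v | Con 'c "('v, 'c) tree list"

inductive_set fin_trees :: "('c \<Rightarrow> nat) \<Rightarrow> ('v, 'c) tree set" for ar :: "'c \<Rightarrow> nat" where
  Var: "Var x \<in> fin_trees ar"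
| Con: "length ts = ar f \<Longrightarrow> (\<And>t. t \<in> set ts \<Longrightarrow> t \<in> fin_trees ar) \<Longrightarrow> Con f ts \<in> fin_trees ar"

coinductive_set inf_trees :: "('c \<Rightarrow> nat) \<Rightarrow> ('v, 'c) tree set" for ar :: "'c \<Rightarrow> nat" where
  Var: "Var x \<in> inf_trees ar"
| Con: "length ts = ar f \<Longrightarrow> (\<And>t. t \<in> set ts \<Longrightarrow> t \<in> inf_trees ar) \<Longrightarrow> Con f ts \<in> inf_trees ar"

lemma fin_trees_subset_inf_trees: "fin_trees ar \<subseteq> inf_trees ar"
proof
  fix t assume "t \<in> fin_trees ar"
  then show "t \<in> inf_trees ar"
    by induction (auto intro: inf_trees.intros)
qed

text \<open>\<open>Head f [x\<^sub>1, \<dots>, x\<^sub>n]\<close> is the head tree \<open>f(x\<^sub>1, \<dots>, x\<^sub>n)\<close>, an element of \<open>T\<close> via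
  \<open>head_tree\<close> when it respects the arities.\<close>

datatype ('v, 'c) head = Head (head_con: 'c) (head_args: "'v list")

fun head_tree :: "('v, 'c) head \<Rightarrow> ('v, 'c) tree" where
  "head_tree (Head f xs) = Con f (map Var xs)"

fun head_vars :: "('v, 'c) head \<Rightarrow> 'v set" where
  "head_vars (Head f xs) = set xs"

fun wf_head :: "('c \<Rightarrow> nat) \<Rightarrow> ('v, 'c) head \<Rightarrow> bool" where
  "wf_head ar (Head f xs) \<longleftrightarrow> length xs = ar f"

section \<open>Substitutions\<close>

type_synonym ('v, 'c) subst = "'v \<Rightarrow> ('v, 'c) tree"

definition is_subst :: "('c \<Rightarrow> nat) \<Rightarrow> ('v, 'c) subst \<Rightarrow> bool" where
  "is_subst ar \<sigma> \<longleftrightarrow> (\<forall>x. \<sigma> x \<in> inf_trees ar)"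

primcorec subst_tree :: "('v, 'c) tree \<Rightarrow> ('v, 'c) subst \<Rightarrow> ('v, 'c) tree" where
  "subst_tree t \<sigma> = (case t of
     Var x \<Rightarrow> \<sigma> x
   | Con f ts \<Rightarrow> Con f (map (\<lambda>s. subst_tree s \<sigma>) ts))"

definition subst_comp :: "('v, 'c) subst \<Rightarrow> ('v, 'c) subst \<Rightarrow> ('v, 'c) subst" (infixl "\<circ>\<^sub>s" 55) where
  "(\<sigma> \<circ>\<^sub>s \<tau>) x = subst_tree (\<tau> x) \<sigma>"

section \<open>Equation systems\<close>

text \<open>The triple \<open>(X, y, t)\<close> is the equation \<open>[X \<equiv> y, t]\<close>; \<open>None\<close> is a missing right-hand side.\<close>

type_synonym ('v, 'c) eqn = "'v set \<times> 'v \<times> ('v, 'c) head option"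
type_synonym ('v, 'c) eqsys = "('v, 'c) eqn set"

definition wf_eqn :: "('c \<Rightarrow> nat) \<Rightarrow> ('v, 'c) eqn \<Rightarrow> bool" where
  "wf_eqn ar = (\<lambda>(X, y, t). X \<noteq> {} \<and> y \<in> X \<and> (\<forall>h. t = Some h \<longrightarrow> wf_head ar h))"

definition is_eqsys :: "('c \<Rightarrow> nat) \<Rightarrow> ('v, 'c) eqsys \<Rightarrow> bool" where
  "is_eqsys ar \<Xi> \<longleftrightarrow> finite \<Xi> \<and> (\<forall>e \<in> \<Xi>. wf_eqn ar e) \<and>
     (\<forall>e \<in> \<Xi>. \<forall>e' \<in> \<Xi>. e \<noteq> e' \<longrightarrow> fst e \<inter> fst e' = {})"

definition eq_dom :: "('v, 'c) eqsys \<Rightarrow> 'v set" where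
  "eq_dom \<Xi> = (\<Union>(X, y, t) \<in> \<Xi>. X)"

definition eqn_vars :: "('v, 'c) eqn \<Rightarrow> 'v set" where
  "eqn_vars = (\<lambda>(X, y, t). X \<union> {y} \<union> (case t of None \<Rightarrow> {} | Some h \<Rightarrow> head_vars h))"

definition eqsys_vars :: "('v, 'c) eqsys \<Rightarrow> 'v set" where
  "eqsys_vars \<Xi> = (\<Union>e \<in> \<Xi>. eqn_vars e)"

definition eq_update :: "('v, 'c) eqsys \<Rightarrow> ('v, 'c) eqn \<Rightarrow> ('v, 'c) eqsys" where
  "eq_update \<Xi> e = {e' \<in> \<Xi>. fst e' \<inter> fst e = {}} \<union> {e}"

text \<open>The equation whose left-hand side contains \<open>x\<close>, used only for \<open>x \<in> eq_dom \<Xi>\<close>.\<close>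

definition eqn_of :: "('v, 'c) eqsys \<Rightarrow> 'v \<Rightarrow> ('v, 'c) eqn" where
  "eqn_of \<Xi> x = (THE e. e \<in> \<Xi> \<and> x \<in> fst e)"

lemma eqn_of_eq:
  assumes "is_eqsys ar \<Xi>" "(X, y, t) \<in> \<Xi>" "x \<in> X"
  shows "eqn_of \<Xi> x = (X, y, t)"
  unfolding eqn_of_def
proof (rule the_equality)
  show "(X, y, t) \<in> \<Xi> \<and> x \<in> fst (X, y, t)"
    using assms by simp
next
  fix e assume "e \<in> \<Xi> \<and> x \<in> fst e"
  then show "e = (X, y, t)"
    using assms unfolding is_eqsys_def by (metis IntI empty_iff fst_conv)
qed

primcorec eq_image :: "('v, 'c) eqsys \<Rightarrow> 'v \<Rightarrow> ('v, 'c) tree" where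
  "eq_image \<Xi> x =
     (if x \<notin> eq_dom \<Xi> then Var x
      else case eqn_of \<Xi> x of (X, y, t) \<Rightarrow>
        (case t of
           None \<Rightarrow> Var y
         | Some h \<Rightarrow> (case h of Head f xs \<Rightarrow> Con f (map (eq_image \<Xi>) xs))))"

section \<open>Operations\<close>

definition eq_find :: "('v, 'c) eqsys \<Rightarrow> 'v \<Rightarrow> 'v \<times> ('v, 'c) head option" where
  "eq_find \<Xi> x =
     (if x \<notin> eq_dom \<Xi> then (x, None)
      else case eqn_of \<Xi> x of (X, x', t) \<Rightarrow> (x', t))"

definition eq_bind :: "('v, 'c) eqsys \<Rightarrow> 'v \<Rightarrow> ('v, 'c) head \<Rightarrow> ('v, 'c) eqsys" where
  "eq_bind \<Xi> x h =
     (if x \<notin> eq_dom \<Xi> then eq_update \<Xi> ({x}, x, Some h)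
      else case eqn_of \<Xi> x of (X, x', t') \<Rightarrow> eq_update \<Xi> (X, x', Some h))"

text \<open>The fourth branch is \<open>eq_union \<Xi> y x\<close>, which is then the third branch, written out.\<close>

definition eq_union :: "('v, 'c) eqsys \<Rightarrow> 'v \<Rightarrow> 'v \<Rightarrow>
    ('v, 'c) eqsys \<times> (('v, 'c) head \<times> ('v, 'c) head) option" where
  "eq_union \<Xi> x y =
     (if x = y then (\<Xi>, None)
      else if x \<notin> eq_dom \<Xi> \<and> y \<notin> eq_dom \<Xi> then (eq_update \<Xi> ({x, y}, x, None), None)
      else if y \<notin> eq_dom \<Xi> then
        (case eqn_of \<Xi> x of (X, x', t) \<Rightarrow> (eq_update \<Xi> (X \<union> {y}, x', t), None))
      else if x \<notin> eq_dom \<Xi> then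
        (case eqn_of \<Xi> y of (Y, y', t) \<Rightarrow> (eq_update \<Xi> (Y \<union> {x}, y', t), None))
      else if eqn_of \<Xi> x = eqn_of \<Xi> y then (\<Xi>, None)
      else
        (case eqn_of \<Xi> x of (X, x', t\<^sub>1) \<Rightarrow> case eqn_of \<Xi> y of (Y, y', t\<^sub>2) \<Rightarrow>
          (case (t\<^sub>1, t\<^sub>2) of
             (Some h\<^sub>1, Some h\<^sub>2) \<Rightarrow> (eq_update \<Xi> (X \<union> Y, x', Some h\<^sub>1), Some (h\<^sub>1, h\<^sub>2))
           | (Some h\<^sub>1, None) \<Rightarrow> (eq_update \<Xi> (X \<union> Y, x', Some h\<^sub>1), None)
           | (None, Some h\<^sub>2) \<Rightarrow> (eq_update \<Xi> (X \<union> Y, x', Some h\<^sub>2), None)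
           | (None, None) \<Rightarrow> (eq_update \<Xi> (X \<union> Y, x', None), None))))"

section \<open>The unification algorithm\<close>

text \<open>A big-step semantics: the algorithm is nondeterministic in the choice of fresh variables.
  The set \<open>U\<close> carries the variables of the original inputs and those generated so far. The result
  is \<open>None\<close> on failure, and otherwise the final \<open>U\<close> together with the computed system.
  The predicate \<open>unify_lists\<close> unifies two argument lists from left to right.\<close>

inductive
  unify_state :: "'v set \<Rightarrow> ('v, 'c) eqsys \<Rightarrow> ('v, 'c) tree \<Rightarrow> ('v, 'c) tree \<Rightarrow>
    ('v set \<times> ('v, 'c) eqsys) option \<Rightarrow> bool" and
  unify_lists :: "'v set \<Rightarrow> ('v, 'c) eqsys \<Rightarrow> ('v, 'c) tree list \<Rightarrow> ('v, 'c) tree list \<Rightarrow>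
    ('v set \<times> ('v, 'c) eqsys) option \<Rightarrow> bool"
where
  Var_Var: "eq_union \<Xi> x y = (\<Xi>', None) \<Longrightarrow>
    unify_state U \<Xi> (Var x) (Var y) (Some (U, \<Xi>'))"
| Var_Var_heads: "eq_union \<Xi> x y = (\<Xi>', Some (h\<^sub>1, h\<^sub>2)) \<Longrightarrow>
    unify_state U \<Xi>' (head_tree h\<^sub>1) (head_tree h\<^sub>2) r \<Longrightarrow>
    unify_state U \<Xi> (Var x) (Var y) r"
| Var_Con_bound: "eq_find \<Xi> x = (x', Some h) \<Longrightarrow>
    unify_state U \<Xi> (head_tree h) (Con f ts) r \<Longrightarrow>
    unify_state U \<Xi> (Var x) (Con f ts) r"
| Var_Con_fresh: "eq_find \<Xi> x = (x', None) \<Longrightarrow>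
    length ys = length ts \<Longrightarrow> distinct ys \<Longrightarrow> set ys \<inter> (U \<union> eqsys_vars \<Xi>) = {} \<Longrightarrow>
    unify_lists (U \<union> set ys) (eq_bind \<Xi> x' (Head f ys)) (map Var ys) ts r \<Longrightarrow>
    unify_state U \<Xi> (Var x) (Con f ts) r"
| Con_Var: "unify_state U \<Xi> (Var x) (Con f ts) r \<Longrightarrow>
    unify_state U \<Xi> (Con f ts) (Var x) r"
| Con_Con: "unify_lists U \<Xi> ts ss r \<Longrightarrow>
    unify_state U \<Xi> (Con f ts) (Con f ss) r"
| Con_Con_clash: "f \<noteq> g \<Longrightarrow>
    unify_state U \<Xi> (Con f ts) (Con g ss) None"
| Nil: "unify_lists U \<Xi> [] [] (Some (U, \<Xi>))"
| Cons: "unify_state U \<Xi> t s (Some (U', \<Xi>')) \<Longrightarrow>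
    unify_lists U' \<Xi>' ts ss r \<Longrightarrow>
    unify_lists U \<Xi> (t # ts) (s # ss) r"
| Cons_fail: "unify_state U \<Xi> t s None \<Longrightarrow>
    unify_lists U \<Xi> (t # ts) (s # ss) None"

text \<open>\<open>unify \<Xi> t s r\<close>: some run of the algorithm on the inputs \<open>\<Xi>\<close>, \<open>t\<close>, \<open>s\<close> returns \<open>r\<close>.\<close>

definition unify :: "('v, 'c) eqsys \<Rightarrow> ('v, 'c) tree \<Rightarrow> ('v, 'c) tree \<Rightarrow>
    ('v, 'c) eqsys option \<Rightarrow> bool" where
  "unify \<Xi> t s r \<longleftrightarrow>
     (\<exists>r'. unify_state (tree_vars t \<union> tree_vars s \<union> eqsys_vars \<Xi>) \<Xi> t s r' \<and> r = map_option snd r')"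

end

theory Submission
  imports Defs
begin

text \<open>A substitution factors through the image of \<open>\<Xi>\<close> exactly when it satisfies every equation of
  \<open>\<Xi>\<close>, and then it is itself the factor. By induction on the run, every substitution that
  satisfies the final system satisfies the initial one and unifies the two inputs. This holds in
  particular for the image of the final system. When a union drops a head tree \<open>h\<^sub>2\<close> in favour of
  \<open>h\<^sub>1\<close>, the equation lost is recovered because the recursive call unifies \<open>h\<^sub>1\<close> and \<open>h\<^sub>2\<close>.\<close>

section \<open>Substitutions as solutions of equation systems\<close>

definition solves_eqn :: "('v, 'c) subst \<Rightarrow> ('v, 'c) eqn \<Rightarrow> bool" where
  "solves_eqn \<sigma> = (\<lambda>(X, y, t). (\<forall>x \<in> X. \<sigma> x = \<sigma> y) \<and>
     (\<forall>h. t = Some h \<longrightarrow> \<sigma> y = subst_tree (head_tree h) \<sigma>))"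

definition solves :: "('v, 'c) subst \<Rightarrow> ('v, 'c) eqsys \<Rightarrow> bool" where
  "solves \<sigma> \<Xi> \<longleftrightarrow> (\<forall>e \<in> \<Xi>. solves_eqn \<sigma> e)"

declare subst_tree.simps [simp del] eq_image.simps [simp del]

lemma subst_tree_Var [simp]: "subst_tree (Var x) \<sigma> = \<sigma> x"
  by (subst subst_tree.code) simp

lemma subst_tree_Con [simp]: "subst_tree (Con f ts) \<sigma> = Con f (map (\<lambda>t. subst_tree t \<sigma>) ts)"
  by (subst subst_tree.code) simp

lemma head_tree_fin_trees: "wf_head ar h \<Longrightarrow> head_tree h \<in> fin_trees ar"
  by (cases h) (auto intro!: fin_trees.intros)

lemma Con_fin_trees_iff:
  "Con f ts \<in> fin_trees ar \<longleftrightarrow> length ts = ar f \<and> set ts \<subseteq> fin_trees ar"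
  by (auto elim: fin_trees.cases intro: fin_trees.Con)

lemma mem_eq_dom_iff: "x \<in> eq_dom \<Xi> \<longleftrightarrow> (\<exists>X y t. (X, y, t) \<in> \<Xi> \<and> x \<in> X)"
  by (auto simp: eq_dom_def)

lemma eq_domE:
  assumes "is_eqsys ar \<Xi>" "x \<in> eq_dom \<Xi>"
  obtains X y t where "(X, y, t) \<in> \<Xi>" "x \<in> X" "y \<in> X" "eqn_of \<Xi> x = (X, y, t)"
    "wf_eqn ar (X, y, t)"
proof -
  obtain X y t where e: "(X, y, t) \<in> \<Xi>" "x \<in> X"
    using assms(2) by (auto simp: mem_eq_dom_iff)
  moreover have "wf_eqn ar (X, y, t)"
    using assms(1) e(1) by (auto simp: is_eqsys_def)
  ultimately show thesis
    using that eqn_of_eq[OF assms(1) e] by (auto simp: wf_eqn_def)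
qed

lemma eqn_eqI:
  assumes "is_eqsys ar \<Xi>" "e \<in> \<Xi>" "e' \<in> \<Xi>" "fst e \<inter> fst e' \<noteq> {}"
  shows "e = e'"
  using assms unfolding is_eqsys_def by blast

section \<open>The image as a solution through which all others factor\<close>

lemma eq_image_notin: "x \<notin> eq_dom \<Xi> \<Longrightarrow> eq_image \<Xi> x = Var x"
  by (subst eq_image.code) simp

lemma eq_image_None: "x \<in> eq_dom \<Xi> \<Longrightarrow> eqn_of \<Xi> x = (X, y, None) \<Longrightarrow> eq_image \<Xi> x = Var y"
  by (subst eq_image.code) simp

lemma eq_image_Some:
  "x \<in> eq_dom \<Xi> \<Longrightarrow> eqn_of \<Xi> x = (X, y, Some (Head f xs)) \<Longrightarrow>
    eq_image \<Xi> x = Con f (map (eq_image \<Xi>) xs)"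
  by (subst eq_image.code) simp

text \<open>One unfolding of \<open>eq_image\<close> at \<open>x\<close> depends only on the
  equation containing \<open>x\<close>, so all members of a left-hand side get the same tree, and a
  head present there is unfolded with the image itself on its arguments. Hence every system, even a
  cyclic one, has a solution.\<close>

lemma eq_image_solves:
  assumes "is_eqsys ar \<Xi>"
  shows "solves (eq_image \<Xi>) \<Xi>"
  unfolding solves_def
proof
  fix e assume "e \<in> \<Xi>"
  then obtain X y t where e: "e = (X, y, t)" "(X, y, t) \<in> \<Xi>"
    by (cases e) auto
  have y: "y \<in> X"
    using assms e by (auto simp: is_eqsys_def wf_eqn_def)
  have of: "x \<in> eq_dom \<Xi> \<and> eqn_of \<Xi> x = (X, y, t)" if "x \<in> X" for x
    using that e(2) eqn_of_eq[OF assms e(2)] by (auto simp: mem_eq_dom_iff)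
  show "solves_eqn (eq_image \<Xi>) e"
  proof (cases t)
    case None
    then have "eq_image \<Xi> x = Var y" if "x \<in> X" for x
      using of[OF that] eq_image_None by fastforce
    then show ?thesis
      using y None by (simp add: e solves_eqn_def)
  next
    case (Some h)
    obtain f xs where h: "h = Head f xs"
      by (cases h)
    have "eq_image \<Xi> x = Con f (map (eq_image \<Xi>) xs)" if "x \<in> X" for x
      using of[OF that] eq_image_Some[of x \<Xi> X y f xs] Some h by simp
    then show ?thesis
      using y Some by (simp add: e h solves_eqn_def comp_def)
  qed
qed

text \<open>Compare \<open>\<sigma> x\<close> with the \<open>\<sigma>\<close>-instance of the image
  of \<open>x\<close> layer by layer. A head at \<open>x\<close> gives both trees the same
  constructor and leaves pairs of the same kind as arguments; without a head the two trees already
  coincide.\<close>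

lemma solves_factor:
  assumes sys: "is_eqsys ar \<Xi>" and sol: "solves \<sigma> \<Xi>"
  shows "\<sigma> = \<sigma> \<circ>\<^sub>s eq_image \<Xi>"
proof
  fix x
  \<comment> \<open>A bisimulation up to equality, as strong coinduction admits. Equality covers
    variables outside the domain and equations without a head, where no further layer is
    compared.\<close>
  define R where "R = (\<lambda>a b. a = b \<or> (\<exists>x. a = \<sigma> x \<and> b = subst_tree (eq_image \<Xi> x) \<sigma>))"
  have step: "\<sigma> x = subst_tree (eq_image \<Xi> x) \<sigma> \<or>
    (\<exists>f ts ss. \<sigma> x = Con f ts \<and> subst_tree (eq_image \<Xi> x) \<sigma> = Con f ss \<and> list_all2 R ts ss)" for x
  proof (cases "x \<in> eq_dom \<Xi>")
    case False
    then show ?thesis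
      by (simp add: eq_image_notin)
  next
    case True
    then obtain X y t where e: "(X, y, t) \<in> \<Xi>" "x \<in> X" "eqn_of \<Xi> x = (X, y, t)"
      using sys by (blast elim: eq_domE)
    have s: "solves_eqn \<sigma> (X, y, t)"
      using sol e(1) by (auto simp: solves_def)
    show ?thesis
    proof (cases t)
      case None
      then show ?thesis
        using s e True by (simp add: solves_eqn_def eq_image_None)
    next
      case (Some h)
      obtain f xs where h: "h = Head f xs"
        by (cases h)
      have "\<sigma> x = Con f (map \<sigma> xs)"
        using s e(2) Some h by (simp add: solves_eqn_def comp_def)
      moreover have "subst_tree (eq_image \<Xi> x) \<sigma> =
          Con f (map (\<lambda>z. subst_tree (eq_image \<Xi> z) \<sigma>) xs)"
        using True e(3) Some h by (simp add: eq_image_Some comp_def)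
      moreover have "list_all2 R (map \<sigma> xs) (map (\<lambda>z. subst_tree (eq_image \<Xi> z) \<sigma>) xs)"
        by (auto simp: R_def list_all2_conv_all_nth)
      ultimately show ?thesis
        by blast
    qed
  qed
  have "\<sigma> x = subst_tree (eq_image \<Xi> x) \<sigma>"
  proof (coinduction arbitrary: x rule: tree.coinduct_strong)
    case (Eq_tree x)
    have R: "list_all2 (\<lambda>a b. (\<exists>x. a = \<sigma> x \<and> b = subst_tree (eq_image \<Xi> x) \<sigma>) \<or> a = b) ts ss"
      if "list_all2 R ts ss" for ts ss
      using that unfolding R_def by (rule list_all2_mono) blast
    from step[of x] show ?case
    proof
      assume "\<sigma> x = subst_tree (eq_image \<Xi> x) \<sigma>"
      then show ?thesis
        by (simp add: list.rel_refl)
    next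
      assume "\<exists>f ts ss. \<sigma> x = Con f ts \<and> subst_tree (eq_image \<Xi> x) \<sigma> = Con f ss \<and> list_all2 R ts ss"
      then show ?thesis
        using R by auto
    qed
  qed
  then show "\<sigma> x = (\<sigma> \<circ>\<^sub>s eq_image \<Xi>) x"
    by (simp add: subst_comp_def)
qed

text \<open>Needed because the final image will itself serve as the factor. Arities are respected
  since each layer is a variable or a well-formed head.\<close>

lemma eq_image_is_subst:
  assumes sys: "is_eqsys ar \<Xi>"
  shows "is_subst ar (eq_image \<Xi>)"
proof -
  have "t \<in> inf_trees ar" if "t = eq_image \<Xi> x" for t x
    using that
  proof (coinduction arbitrary: t x rule: inf_trees.coinduct)
    case (inf_trees t x)
    show ?case
    proof (cases "x \<in> eq_dom \<Xi>")
      case False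
      then show ?thesis
        by (simp add: inf_trees eq_image_notin)
    next
      case True
      then obtain X y r where e: "eqn_of \<Xi> x = (X, y, r)" "wf_eqn ar (X, y, r)"
        using sys by (blast elim: eq_domE)
      show ?thesis
      proof (cases r)
        case None
        then show ?thesis
          using True e by (simp add: inf_trees eq_image_None)
      next
        case (Some h)
        then show ?thesis
          using True e by (cases h) (auto simp: inf_trees eq_image_Some wf_eqn_def)
      qed
    qed
  qed
  then show ?thesis
    by (simp add: is_subst_def)
qed

section \<open>Update, find and bind\<close>

lemma is_eqsys_update:
  assumes "is_eqsys ar \<Xi>" "wf_eqn ar e"
  shows "is_eqsys ar (eq_update \<Xi> e)"
proof -
  have "fst e1 \<inter> fst e2 = {}"
    if e: "e1 \<in> eq_update \<Xi> e" "e2 \<in> eq_update \<Xi> e" "e1 \<noteq> e2" for e1 e2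
  proof -
    consider "e1 = e" | "e2 = e" | "e1 \<in> \<Xi>" "e2 \<in> \<Xi>"
      using e(1,2) unfolding eq_update_def by blast
    then show "fst e1 \<inter> fst e2 = {}"
    proof cases
      case 3
      then show ?thesis
        using e(3) eqn_eqI[OF assms(1)] by metis
    qed (use e in \<open>auto simp: eq_update_def\<close>)
  qed
  then show ?thesis
    using assms by (auto simp: is_eqsys_def eq_update_def)
qed

text \<open>Equations disjoint from the new one survive the update, so going back to
  \<open>\<Xi>\<close> only the removed ones have to be recovered. Every operation is treated by
  identifying those.\<close>

lemma solves_updateD:
  assumes "solves \<sigma> (eq_update \<Xi> e)"
  shows "solves_eqn \<sigma> e"
    and "(\<And>e'. e' \<in> \<Xi> \<Longrightarrow> fst e' \<inter> fst e \<noteq> {} \<Longrightarrow> solves_eqn \<sigma> e') \<Longrightarrow> solves \<sigma> \<Xi>"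
proof -
  have upd: "solves_eqn \<sigma> e'" if "e' \<in> eq_update \<Xi> e" for e'
    using assms that unfolding solves_def by (rule bspec)
  show "solves_eqn \<sigma> e"
    by (rule upd) (simp add: eq_update_def)
  assume meet: "\<And>e'. e' \<in> \<Xi> \<Longrightarrow> fst e' \<inter> fst e \<noteq> {} \<Longrightarrow> solves_eqn \<sigma> e'"
  show "solves \<sigma> \<Xi>"
    unfolding solves_def
  proof
    fix e' assume e': "e' \<in> \<Xi>"
    show "solves_eqn \<sigma> e'"
    proof (cases "fst e' \<inter> fst e = {}")
      case True
      then show ?thesis
        using e' by (intro upd) (simp add: eq_update_def)
    next
      case False
      with e' show ?thesis
        by (rule meet)
    qed
  qed
qed

lemma eq_find_Some:
  assumes sys: "is_eqsys ar \<Xi>" and "eq_find \<Xi> x = (x', Some h)"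
  shows "wf_head ar h" and "solves \<sigma> \<Xi> \<Longrightarrow> \<sigma> x = subst_tree (head_tree h) \<sigma>"
proof -
  have dom: "x \<in> eq_dom \<Xi>"
    using assms(2) by (auto simp: eq_find_def split: if_splits)
  obtain X y t where "(X, y, t) \<in> \<Xi>" "x \<in> X" "eqn_of \<Xi> x = (X, y, t)" "wf_eqn ar (X, y, t)"
    using eq_domE[OF sys dom] by metis
  moreover from this have "y = x'" "t = Some h"
    using assms(2) dom by (auto simp: eq_find_def)
  ultimately have e: "(X, x', Some h) \<in> \<Xi>" "x \<in> X" "wf_eqn ar (X, x', Some h)"
    by simp_all
  show "wf_head ar h"
    using e(3) by (simp add: wf_eqn_def)
  show "\<sigma> x = subst_tree (head_tree h) \<sigma>" if "solves \<sigma> \<Xi>"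
    using that e(1,2) by (auto simp: solves_def solves_eqn_def)
qed

lemma eq_bind_None:
  assumes sys: "is_eqsys ar \<Xi>" and find: "eq_find \<Xi> x = (x', None)" and "wf_head ar h"
  shows "is_eqsys ar (eq_bind \<Xi> x' h)"
    and "solves \<sigma> (eq_bind \<Xi> x' h) \<Longrightarrow> solves \<sigma> \<Xi> \<and> \<sigma> x = subst_tree (head_tree h) \<sigma>"
proof -
  \<comment> \<open>Both branches of find and bind take this form: \<open>X\<close> is
    \<open>{x}\<close> with \<open>x' = x\<close>, or the left-hand side of the equation of
    \<open>x\<close>, which has no head. The last disjunct says that at most a headless equation is
    overwritten.\<close>
  obtain X where X: "eq_bind \<Xi> x' h = eq_update \<Xi> (X, x', Some h)" "x \<in> X" "x' \<in> X"
    "X \<inter> eq_dom \<Xi> = {} \<or> (X, x', None) \<in> \<Xi>"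
  proof (cases "x \<in> eq_dom \<Xi>")
    case False
    then have "x' = x"
      using find by (simp add: eq_find_def)
    then show thesis
      using False by (intro that[of "{x}"]) (simp_all add: eq_bind_def)
  next
    case True
    obtain X y t where "(X, y, t) \<in> \<Xi>" "x \<in> X" "y \<in> X" "eqn_of \<Xi> x = (X, y, t)"
      using eq_domE[OF sys True] by metis
    moreover from this have "y = x'" "t = None"
      using find True by (auto simp: eq_find_def)
    ultimately have e: "(X, x', None) \<in> \<Xi>" "x \<in> X" "x' \<in> X"
      by simp_all
    moreover have "x' \<in> eq_dom \<Xi>"
      using e by (auto simp: mem_eq_dom_iff)
    ultimately show thesis
      using eqn_of_eq[OF sys e(1,3)] by (intro that[of X]) (simp_all add: eq_bind_def)
  qed
  have "wf_eqn ar (X, x', Some h)"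
    using assms(3) X(3) by (auto simp: wf_eqn_def)
  then show "is_eqsys ar (eq_bind \<Xi> x' h)"
    using sys X(1) is_eqsys_update by metis
  assume sol: "solves \<sigma> (eq_bind \<Xi> x' h)"
  note sol' = sol[unfolded X(1)]
  note e = solves_updateD(1)[OF sol']
  have "solves_eqn \<sigma> e'" if e': "e' \<in> \<Xi>" "fst e' \<inter> fst (X, x', Some h) \<noteq> {}" for e'
  proof -
    \<comment> \<open>Since \<open>e'\<close> meets \<open>X\<close>, the first alternative for
      \<open>X\<close> is excluded.\<close>
    have "(X, x', None) \<in> \<Xi>"
      using X(4) e' by (cases e') (auto simp: eq_dom_def)
    then have "e' = (X, x', None)"
      using eqn_eqI[OF sys e'(1)] e'(2) by simp
    then show ?thesis
      using e by (simp add: solves_eqn_def)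
  qed
  then have "solves \<sigma> \<Xi>"
    by (rule solves_updateD(2)[OF sol'])
  then show "solves \<sigma> \<Xi> \<and> \<sigma> x = subst_tree (head_tree h) \<sigma>"
    using e X(2) by (simp add: solves_eqn_def)
qed

section \<open>Union\<close>

definition unifies_heads ::
    "('v, 'c) subst \<Rightarrow> (('v, 'c) head \<times> ('v, 'c) head) option \<Rightarrow> bool" where
  "unifies_heads \<sigma> p \<longleftrightarrow>
     (\<forall>h\<^sub>1 h\<^sub>2. p = Some (h\<^sub>1, h\<^sub>2) \<longrightarrow>
       subst_tree (head_tree h\<^sub>1) \<sigma> = subst_tree (head_tree h\<^sub>2) \<sigma>)"

text \<open>No equation contains \<open>z\<close>, so the only one removed is
  \<open>(X, y, t)\<close>, which its extension implies. This serves both cases of a union with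
  exactly one variable in the domain.\<close>

lemma update_extend:
  assumes sys: "is_eqsys ar \<Xi>" and e: "(X, y, t) \<in> \<Xi>" and z: "z \<notin> eq_dom \<Xi>"
  shows "is_eqsys ar (eq_update \<Xi> (X \<union> {z}, y, t))"
    and "solves \<sigma> (eq_update \<Xi> (X \<union> {z}, y, t)) \<Longrightarrow> solves \<sigma> \<Xi> \<and> (\<forall>x \<in> X. \<sigma> x = \<sigma> z)"
proof -
  have "wf_eqn ar (X, y, t)"
    using sys e by (auto simp: is_eqsys_def)
  then have "wf_eqn ar (X \<union> {z}, y, t)"
    by (auto simp: wf_eqn_def)
  then show "is_eqsys ar (eq_update \<Xi> (X \<union> {z}, y, t))"
    using sys is_eqsys_update by metis
  assume sol: "solves \<sigma> (eq_update \<Xi> (X \<union> {z}, y, t))"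
  note s = solves_updateD(1)[OF sol]
  have "solves_eqn \<sigma> e'" if e': "e' \<in> \<Xi>" "fst e' \<inter> fst (X \<union> {z}, y, t) \<noteq> {}" for e'
  proof -
    have "z \<notin> fst e'"
      using z e'(1) by (auto simp: eq_dom_def)
    then have "e' = (X, y, t)"
      using eqn_eqI[OF sys e'(1) e] e'(2) by auto
    then show ?thesis
      using s by (simp add: solves_eqn_def)
  qed
  then have "solves \<sigma> \<Xi>"
    by (rule solves_updateD(2)[OF sol])
  then show "solves \<sigma> \<Xi> \<and> (\<forall>x \<in> X. \<sigma> x = \<sigma> z)"
    using s by (simp add: solves_eqn_def)
qed

text \<open>Only the two merged equations are removed. The new one makes \<open>\<sigma>\<close>
  constant on \<open>X \<union> Y\<close>, which recovers both left-hand sides; the premise on heads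
  recovers whichever right-hand side was dropped.\<close>

lemma update_merge:
  assumes sys: "is_eqsys ar \<Xi>" and e: "(X, x', t\<^sub>1) \<in> \<Xi>" "(Y, y', t\<^sub>2) \<in> \<Xi>"
    and t: "t = t\<^sub>1 \<or> t = t\<^sub>2"
  shows "is_eqsys ar (eq_update \<Xi> (X \<union> Y, x', t))"
    and "solves \<sigma> (eq_update \<Xi> (X \<union> Y, x', t)) \<Longrightarrow>
      (\<And>h. t\<^sub>1 = Some h \<or> t\<^sub>2 = Some h \<Longrightarrow>
        \<exists>h'. t = Some h' \<and> subst_tree (head_tree h) \<sigma> = subst_tree (head_tree h') \<sigma>) \<Longrightarrow>
      solves \<sigma> \<Xi> \<and> (\<forall>x \<in> X. \<forall>y \<in> Y. \<sigma> x = \<sigma> y)"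
proof -
  have wf: "wf_eqn ar (X, x', t\<^sub>1)" "wf_eqn ar (Y, y', t\<^sub>2)"
    using sys e by (auto simp: is_eqsys_def)
  then have "wf_eqn ar (X \<union> Y, x', t)"
    using t by (auto simp: wf_eqn_def)
  then show "is_eqsys ar (eq_update \<Xi> (X \<union> Y, x', t))"
    using sys is_eqsys_update by metis
  \<comment> \<open>The second equation is stated at \<open>y'\<close>, the merged one at
    \<open>x'\<close>; this membership gives \<open>\<sigma> y' = \<sigma> x'\<close>.\<close>
  have y': "y' \<in> Y"
    using wf by (simp add: wf_eqn_def)
  assume sol: "solves \<sigma> (eq_update \<Xi> (X \<union> Y, x', t))"
  assume heads: "\<And>h. t\<^sub>1 = Some h \<or> t\<^sub>2 = Some h \<Longrightarrow>
    \<exists>h'. t = Some h' \<and> subst_tree (head_tree h) \<sigma> = subst_tree (head_tree h') \<sigma>"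
  note s = solves_updateD(1)[OF sol]
  have "solves_eqn \<sigma> e'" if e': "e' \<in> \<Xi>" "fst e' \<inter> fst (X \<union> Y, x', t) \<noteq> {}" for e'
  proof -
    have "e' = (X, x', t\<^sub>1) \<or> e' = (Y, y', t\<^sub>2)"
      using eqn_eqI[OF sys e'(1) e(1)] eqn_eqI[OF sys e'(1) e(2)] e'(2) by auto
    then show ?thesis
      using s y' heads by (fastforce simp: solves_eqn_def)
  qed
  then have "solves \<sigma> \<Xi>"
    by (rule solves_updateD(2)[OF sol])
  then show "solves \<sigma> \<Xi> \<and> (\<forall>x \<in> X. \<forall>y \<in> Y. \<sigma> x = \<sigma> y)"
    using s by (simp add: solves_eqn_def)
qed

text \<open>A union loses information only when both equations carry heads. The missing fact is then
  precisely \<open>unifies_heads \<sigma> p\<close>, an obligation left to the recursive call and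
  vacuous when \<open>p\<close> is \<open>None\<close>.\<close>

lemma eq_union_correct:
  assumes sys: "is_eqsys ar \<Xi>" and un: "eq_union \<Xi> x y = (\<Xi>', p)"
  shows "is_eqsys ar \<Xi>' \<and> (\<forall>h\<^sub>1 h\<^sub>2. p = Some (h\<^sub>1, h\<^sub>2) \<longrightarrow> wf_head ar h\<^sub>1 \<and> wf_head ar h\<^sub>2) \<and>
    (\<forall>\<sigma>. solves \<sigma> \<Xi>' \<longrightarrow> unifies_heads \<sigma> p \<longrightarrow> solves \<sigma> \<Xi> \<and> \<sigma> x = \<sigma> y)"
proof -
  consider (same) "x = y"
    | (none) "x \<noteq> y" "x \<notin> eq_dom \<Xi>" "y \<notin> eq_dom \<Xi>"
    | (left) "x \<noteq> y" "x \<in> eq_dom \<Xi>" "y \<notin> eq_dom \<Xi>"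
    | (right) "x \<noteq> y" "x \<notin> eq_dom \<Xi>" "y \<in> eq_dom \<Xi>"
    | (both) "x \<noteq> y" "x \<in> eq_dom \<Xi>" "y \<in> eq_dom \<Xi>"
    by blast
  then show ?thesis
  proof cases
    case same
    then show ?thesis
      using sys un by (simp add: eq_union_def)
  next
    case none
    then have res: "\<Xi>' = eq_update \<Xi> ({x, y}, x, None)" "p = None"
      using un by (auto simp: eq_union_def)
    have "is_eqsys ar \<Xi>'"
      unfolding res(1) by (rule is_eqsys_update[OF sys]) (simp add: wf_eqn_def)
    moreover have "solves \<sigma> \<Xi> \<and> \<sigma> x = \<sigma> y" if "solves \<sigma> \<Xi>'" for \<sigma>
    proof -
      note sol = that[unfolded res(1)]
      have "solves \<sigma> \<Xi>"
        using none by (intro solves_updateD(2)[OF sol]) (auto simp: eq_dom_def)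
      then show ?thesis
        using solves_updateD(1)[OF sol] by (simp add: solves_eqn_def)
    qed
    ultimately show ?thesis
      using res(2) by simp
  next
    case left
    then obtain X x' t where e: "(X, x', t) \<in> \<Xi>" "x \<in> X" "eqn_of \<Xi> x = (X, x', t)"
      using sys by (blast elim: eq_domE)
    then have "\<Xi>' = eq_update \<Xi> (X \<union> {y}, x', t)" "p = None"
      using un left by (auto simp: eq_union_def)
    then show ?thesis
      using update_extend[OF sys e(1) left(3)] e(2) by blast
  next
    case right
    then obtain Y y' t where e: "(Y, y', t) \<in> \<Xi>" "y \<in> Y" "eqn_of \<Xi> y = (Y, y', t)"
      using sys by (blast elim: eq_domE)
    then have "\<Xi>' = eq_update \<Xi> (Y \<union> {x}, y', t)" "p = None"
      using un right by (auto simp: eq_union_def)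
    then show ?thesis
      using update_extend[OF sys e(1) right(2)] e(2) by (metis option.distinct(1))
  next
    case both
    obtain X x' t\<^sub>1 where X: "(X, x', t\<^sub>1) \<in> \<Xi>" "x \<in> X" "eqn_of \<Xi> x = (X, x', t\<^sub>1)"
        "wf_eqn ar (X, x', t\<^sub>1)"
      using both sys by (blast elim: eq_domE)
    obtain Y y' t\<^sub>2 where Y: "(Y, y', t\<^sub>2) \<in> \<Xi>" "y \<in> Y" "eqn_of \<Xi> y = (Y, y', t\<^sub>2)"
        "wf_eqn ar (Y, y', t\<^sub>2)"
      using both sys by (blast elim: eq_domE)
    show ?thesis
    proof (cases "eqn_of \<Xi> x = eqn_of \<Xi> y")
      case True
      then have "\<Xi>' = \<Xi>" "p = None"
        using un both by (auto simp: eq_union_def)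
      moreover have "\<sigma> x = \<sigma> y" if "solves \<sigma> \<Xi>" for \<sigma>
        using that True X Y by (fastforce simp: solves_def solves_eqn_def)
      ultimately show ?thesis
        using sys by simp
    next
      case False
      \<comment> \<open>The first head if there is one, otherwise the second right-hand side: this
        merges the four combinations of present and missing heads into one update.\<close>
      define t where "t = (case t\<^sub>1 of None \<Rightarrow> t\<^sub>2 | Some h \<Rightarrow> Some h)"
      have t: "t = t\<^sub>1 \<or> t = t\<^sub>2"
        by (auto simp: t_def split: option.splits)
      have "eq_union \<Xi> x y = (eq_update \<Xi> (X \<union> Y, x', t),
          case (t\<^sub>1, t\<^sub>2) of (Some h\<^sub>1, Some h\<^sub>2) \<Rightarrow> Some (h\<^sub>1, h\<^sub>2) | _ \<Rightarrow> None)"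
        using both False unfolding eq_union_def t_def X(3) Y(3)
        by (auto split: option.split)
      then have res: "\<Xi>' = eq_update \<Xi> (X \<union> Y, x', t)"
          "p = (case (t\<^sub>1, t\<^sub>2) of (Some h\<^sub>1, Some h\<^sub>2) \<Rightarrow> Some (h\<^sub>1, h\<^sub>2) | _ \<Rightarrow> None)"
        using un by simp_all
      have "is_eqsys ar \<Xi>'"
        unfolding res(1) by (rule update_merge(1)[OF sys X(1) Y(1) t])
      moreover have "wf_head ar h\<^sub>1 \<and> wf_head ar h\<^sub>2" if "p = Some (h\<^sub>1, h\<^sub>2)" for h\<^sub>1 h\<^sub>2
        using that res(2) X(4) Y(4) by (auto simp: wf_eqn_def split: option.splits)
      moreover have "solves \<sigma> \<Xi> \<and> \<sigma> x = \<sigma> y" if "solves \<sigma> \<Xi>'" "unifies_heads \<sigma> p" for \<sigma>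
      proof -
        have "solves \<sigma> \<Xi> \<and> (\<forall>x \<in> X. \<forall>y \<in> Y. \<sigma> x = \<sigma> y)"
        proof (rule update_merge(2)[OF sys X(1) Y(1) t])
          show "solves \<sigma> (eq_update \<Xi> (X \<union> Y, x', t))"
            using that(1) res(1) by simp
          \<comment> \<open>With two heads, the dropped one agrees with the kept one under
            \<open>\<sigma>\<close> by \<open>unifies_heads\<close>; with a single head, that head
            is the kept one.\<close>
          show "\<exists>h'. t = Some h' \<and> subst_tree (head_tree h) \<sigma> = subst_tree (head_tree h') \<sigma>"
            if "t\<^sub>1 = Some h \<or> t\<^sub>2 = Some h" for h
            using that \<open>unifies_heads \<sigma> p\<close>
            by (auto simp: res(2) t_def unifies_heads_def split: option.splits)
        qed
        then show ?thesis
          using X(2) Y(2) by blast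
      qed
      ultimately show ?thesis
        by blast
    qed
  qed
qed

section \<open>Correctness of runs\<close>

text \<open>Well-formedness travels forward along the run, solutions travel backward. Keeping the
  result as \<open>r\<close> with a separate equation lets the induction range over failing runs
  too, where the claim is vacuous.\<close>

lemma unify_correct:
  "unify_state U \<Xi> t s r \<Longrightarrow> is_eqsys ar \<Xi> \<Longrightarrow> t \<in> fin_trees ar \<Longrightarrow> s \<in> fin_trees ar \<Longrightarrow>
    r = Some (U', \<Xi>') \<Longrightarrow>
    is_eqsys ar \<Xi>' \<and> (\<forall>\<sigma>. solves \<sigma> \<Xi>' \<longrightarrow> solves \<sigma> \<Xi> \<and> subst_tree t \<sigma> = subst_tree s \<sigma>)"
  "unify_lists U \<Xi> ts ss r \<Longrightarrow> is_eqsys ar \<Xi> \<Longrightarrow>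
    set ts \<subseteq> fin_trees ar \<Longrightarrow> set ss \<subseteq> fin_trees ar \<Longrightarrow> r = Some (U', \<Xi>') \<Longrightarrow>
    is_eqsys ar \<Xi>' \<and> (\<forall>\<sigma>. solves \<sigma> \<Xi>' \<longrightarrow>
      solves \<sigma> \<Xi> \<and> map (\<lambda>t. subst_tree t \<sigma>) ts = map (\<lambda>t. subst_tree t \<sigma>) ss)"
proof (induction arbitrary: U' \<Xi>' and U' \<Xi>' rule: unify_state_unify_lists.inducts)
  case (Var_Var \<Xi> x y \<Xi>'' U)
  then show ?case
    using eq_union_correct[of ar \<Xi> x y \<Xi>'' None] by (simp add: unifies_heads_def)
next
  case (Var_Var_heads \<Xi> x y \<Xi>'' h\<^sub>1 h\<^sub>2 U r)
  \<comment> \<open>The recursive call makes \<open>\<sigma>\<close> unify the two heads, which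
    discharges the obligation left by the union.\<close>
  note un = eq_union_correct[OF Var_Var_heads.prems(1) Var_Var_heads.hyps(1)]
  then show ?case
    using Var_Var_heads.IH[of U' \<Xi>'] Var_Var_heads.prems(4)
    by (simp add: head_tree_fin_trees unifies_heads_def)
next
  case (Var_Con_bound \<Xi> x x' h U f ts r)
  note find = eq_find_Some[OF Var_Con_bound.prems(1) Var_Con_bound.hyps(1)]
  have "is_eqsys ar \<Xi>' \<and> (\<forall>\<sigma>. solves \<sigma> \<Xi>' \<longrightarrow>
      solves \<sigma> \<Xi> \<and> subst_tree (head_tree h) \<sigma> = subst_tree (Con f ts) \<sigma>)"
    using Var_Con_bound.IH Var_Con_bound.prems find(1) head_tree_fin_trees by blast
  then show ?case
    using find(2) by (metis subst_tree_Var)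
next
  case (Var_Con_fresh \<Xi> x x' ys ts U f r)
  \<comment> \<open>The input tree fixes the arity of \<open>f\<close>; as \<open>ys\<close> has the
    length of \<open>ts\<close>, the head built from the fresh variables is well-formed.\<close>
  have ts: "length ts = ar f" "set ts \<subseteq> fin_trees ar"
    using Var_Con_fresh.prems(3) by (auto simp: Con_fin_trees_iff)
  then have "wf_head ar (Head f ys)"
    using Var_Con_fresh.hyps by simp
  note bind = eq_bind_None[OF Var_Con_fresh.prems(1) Var_Con_fresh.hyps(1) this]
  have ys: "set (map Var ys) \<subseteq> fin_trees ar"
    by (auto intro: fin_trees.Var)
  have run: "is_eqsys ar \<Xi>' \<and> (\<forall>\<sigma>. solves \<sigma> \<Xi>' \<longrightarrow> solves \<sigma> (eq_bind \<Xi> x' (Head f ys)) \<and>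
      map (\<lambda>t. subst_tree t \<sigma>) (map Var ys) = map (\<lambda>t. subst_tree t \<sigma>) ts)"
    by (rule Var_Con_fresh.IH[OF bind(1) ys ts(2) Var_Con_fresh.prems(4)])
  \<comment> \<open>The binding turns \<open>\<sigma> x\<close> into \<open>f\<close> applied to the
    values of \<open>ys\<close>, and the list run equates these with the instances of
    \<open>ts\<close>.\<close>
  have "\<sigma> x = subst_tree (Con f ts) \<sigma>" if "solves \<sigma> \<Xi>'" for \<sigma>
    using that run bind(2)[of \<sigma>] by (auto simp: comp_def)
  then show ?case
    using run bind(2) by auto
next
  case (Con_Var U \<Xi> x f ts r)
  then show ?case
    by metis
next
  case (Con_Con U \<Xi> ts ss r f)
  then show ?case
    by (simp add: Con_fin_trees_iff)
next
  case (Cons U \<Xi> t s U'' \<Xi>'' ts ss r)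
  \<comment> \<open>A solution of the final system first passes back to the intermediate system;
    there it also unifies the two first trees.\<close>
  have hd: "is_eqsys ar \<Xi>'' \<and> (\<forall>\<sigma>. solves \<sigma> \<Xi>'' \<longrightarrow>
      solves \<sigma> \<Xi> \<and> subst_tree t \<sigma> = subst_tree s \<sigma>)"
    using Cons.IH(1) Cons.prems by simp
  moreover have "is_eqsys ar \<Xi>' \<and> (\<forall>\<sigma>. solves \<sigma> \<Xi>' \<longrightarrow>
      solves \<sigma> \<Xi>'' \<and> map (\<lambda>t. subst_tree t \<sigma>) ts = map (\<lambda>t. subst_tree t \<sigma>) ss)"
    using Cons.IH(2) Cons.prems hd by simp
  ultimately show ?case
    by simp
qed simp_all

theorem mainTheorem2:
  fixes ar :: "'c::{countable, infinite} \<Rightarrow> nat"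
    and t\<^sub>1 t\<^sub>2 :: "('v::{countable, infinite}, 'c) tree"
    and \<Xi> \<Xi>' :: "('v, 'c) eqsys"
  assumes "t\<^sub>1 \<in> fin_trees ar" and "t\<^sub>2 \<in> fin_trees ar"
    and "is_eqsys ar \<Xi>"
    and "unify \<Xi> t\<^sub>1 t\<^sub>2 (Some \<Xi>')"
  shows "(\<exists>\<sigma>. is_subst ar \<sigma> \<and> eq_image \<Xi>' = \<sigma> \<circ>\<^sub>s eq_image \<Xi>) \<and>
    subst_tree t\<^sub>1 (eq_image \<Xi>') = subst_tree t\<^sub>2 (eq_image \<Xi>')"
proof -
  obtain U r where run: "unify_state U \<Xi> t\<^sub>1 t\<^sub>2 r" "Some \<Xi>' = map_option snd r"
    using assms(4) unfolding unify_def by blast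
  then obtain U' where "r = Some (U', \<Xi>')"
    by (cases r) auto
  with run(1) have "unify_state U \<Xi> t\<^sub>1 t\<^sub>2 (Some (U', \<Xi>'))"
    by simp
  \<comment> \<open>The claim for arbitrary solutions is applied to the final image, a solution of
    its own system.\<close>
  from unify_correct(1)[OF this assms(3,1,2) refl]
  have sys': "is_eqsys ar \<Xi>'"
    and sol: "solves (eq_image \<Xi>') \<Xi>" "subst_tree t\<^sub>1 (eq_image \<Xi>') = subst_tree t\<^sub>2 (eq_image \<Xi>')"
    using eq_image_solves by blast+
  \<comment> \<open>The witness for the factor is \<open>eq_image \<Xi>'\<close>: it solves
    \<open>\<Xi>\<close>, hence factors through \<open>eq_image \<Xi>\<close> by itself.\<close>
  show ?thesis
    using eq_image_is_subst[OF sys'] solves_factor[OF assms(3) sol(1)] sol(2) by blast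
qed

end
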